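(* Let $f:\mathbb{R}^n\to\mathbb{R}\cup\{+\infty\}$ be a proper closed convex function with $\operatorname{rank}(f)\le k$, written as $f(x)=g(Ax)+c^\top x$ with $g:\mathbb{R}^k\to\mathbb{R}\cup\{+\infty\}$ proper closed convex, $A$ a $k\times n$ real matrix and $c\in\mathbb{R}^n$, and assume $f(0)=0$. Let $\mathcal{I}_+\subseteq[n]$, and let $\mathcal{Q}$, $\mathcal{V}(\mathcal{I})$ (for $\mathcal I\subseteq[n]$) and $\mathcal{R}$ be the sets defined in the context. Then $$\operatorname{cl\,conv}(\mathcal{Q})=\operatorname{cl\,conv}\left(\Big(\bigcup_{\mathcal{I}\subseteq[n]:\,|\mathcal{I}|\le k}\mathcal{V}(\mathcal{I})\Big)\cup\mathcal{R}\right).$$ Moreover, if $\{x\in\mathbb{R}^n: Ax=0,\ x_i\ge 0\ \forall i\in\mathcal{I}_+\}=\{0\}$, then $\mathcal{R}$ can be removed from the disjunction, i.e. $\operatorname{cl\,conv}(\mathcal{Q})=\operatorname{cl\,conv}\big(\bigcup_{|\mathcal{I}|\le k}\mathcal{V}(\mathcal{I})\big)$.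
   Context: $[n]=\{1,\dots,n\}$; $\operatorname{cl\,conv}(S)$ is the closure of the convex hull of $S$. For a proper closed convex function $f$ on $\mathbb{R}^n$, $\operatorname{rank}(f)$ is the smallest integer $k$ such that $f(x)=g(Ax)+c^\top x$ for some closed convex function $g$, some $k\times n$ matrix $A$ and some $c\in\mathbb{R}^n$. The sets are: $$\mathcal{Q}=\{(t,x,z)\in\mathbb{R}^{n+1}\times\{0,1\}^n:\ t\ge f(x),\ x_i\ge 0\ \forall i\in\mathcal{I}_+,\ x_i(1-z_i)=0\ \forall i\in[n]\},$$ $$\mathcal{X}=\{(t,x)\in\mathbb{R}^{n+1}: t\ge f(x),\ x_i\ge0\ \forall i\in\mathcal{I}_+\},$$ and, for $\mathcal{I}\subseteq[n]$, $\mathcal{X}(\mathcal{I})=\mathcal{X}\cap\{(t,x):x_i=0\ \forall i\notin\mathcal{I}\}$, $\mathcal{Z}(\mathcal{I})=\{z\in\{0,1\}^n: z_i=1\ \forall i\in\mathcal{I}\}$, $\mathcal{V}(\mathcal{I})=\mathcal{X}(\mathcal{I})\times\mathcal{Z}(\mathcal{I})$, and $$\mathcal{R}=\{(t,x,z):\ t\ge c^\top x,\ Ax=0,\ x_i\ge0\ \forall i\in\mathcal{I}_+,\ z_i=1\ \forall i\in[n]\}.$$ *)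

theory Defs
  imports "HOL-Analysis.Analysis"
begin

definition ereal_epigraph :: "('a \<Rightarrow> ereal) \<Rightarrow> ('a \<times> real) set" where
  "ereal_epigraph f = {(x, t). f x \<le> ereal t}"

definition proper_on :: "'a set \<Rightarrow> ('a \<Rightarrow> ereal) \<Rightarrow> bool" where
  "proper_on S f \<longleftrightarrow> (\<forall>x\<in>S. f x \<noteq> -\<infinity>) \<and> (\<exists>x\<in>S. f x \<noteq> \<infinity>)"

definition closed_convex_fun :: "(real^'n \<Rightarrow> ereal) \<Rightarrow> bool" where
  "closed_convex_fun f \<longleftrightarrow> closed (ereal_epigraph f) \<and> convex (ereal_epigraph f)"

text \<open>
  The dimension \<open>k\<close> varies inside the definition of the rank and may be \<open>0\<close>, so it cannot be
  a type index.  We use the library's topological space \<^const>\<open>Euclidean_space\<close>, whose points are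
  the sequences \<open>y :: nat \<Rightarrow> real\<close> with \<open>y i = 0\<close> for all \<open>i \<ge> k\<close>.
  Values of \<open>g\<close> outside \<open>Rvec k\<close> are irrelevant throughout.
\<close>

abbreviation Rvec :: "nat \<Rightarrow> (nat \<Rightarrow> real) set" where
  "Rvec k \<equiv> topspace (Euclidean_space k)"

text \<open>Convexity of the epigraph is spelled out because \<open>nat \<Rightarrow> real\<close> is not an instance of
  \<^class>\<open>real_vector\<close>.\<close>

definition closed_convex_fun_Rvec :: "nat \<Rightarrow> ((nat \<Rightarrow> real) \<Rightarrow> ereal) \<Rightarrow> bool" where
  "closed_convex_fun_Rvec k g \<longleftrightarrow>
     (let E = ereal_epigraph g \<inter> (Rvec k \<times> UNIV) in
        closedin (prod_topology (Euclidean_space k) euclideanreal) E \<and>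
        (\<forall>(y, s)\<in>E. \<forall>(y', s')\<in>E. \<forall>u v. 0 \<le> u \<and> 0 \<le> v \<and> u + v = 1 \<longrightarrow>
           ((\<lambda>i. u * y i + v * y' i), u * s + v * s') \<in> E))"

text \<open>A \<open>k \<times> n\<close> matrix is given by its rows \<open>A 0, \<dots>, A (k - 1)\<close>; other values of \<open>A\<close> are ignored.\<close>

definition mat_app :: "nat \<Rightarrow> (nat \<Rightarrow> real^'n) \<Rightarrow> real^'n \<Rightarrow> (nat \<Rightarrow> real)" where
  "mat_app k A x = (\<lambda>i. if i < k then A i \<bullet> x else 0)"

lemma mat_app_in_Rvec: "mat_app k A x \<in> Rvec k"
  by (simp add: mat_app_def topspace_Euclidean_space)

definition fun_rank :: "(real^'n \<Rightarrow> ereal) \<Rightarrow> nat" where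
  "fun_rank f = (LEAST k. \<exists>(g :: (nat \<Rightarrow> real) \<Rightarrow> ereal) (A :: nat \<Rightarrow> real^'n) c.
     closed_convex_fun_Rvec k g \<and> (\<forall>x. f x = g (mat_app k A x) + ereal (c \<bullet> x)))"

text \<open>In the sets below, the type \<open>'n\<close> plays the role of \<open>[n]\<close>, and a triple \<open>(t, x, z)\<close> is
  encoded as \<open>((t, x), z)\<close>.\<close>

definition setQ :: "(real^'n \<Rightarrow> ereal) \<Rightarrow> 'n set \<Rightarrow> ((real \<times> (real^'n)) \<times> (real^'n)) set" where
  "setQ f Ip = {((t, x), z). (\<forall>i. z $ i \<in> {0, 1}) \<and> f x \<le> ereal t \<and>
     (\<forall>i\<in>Ip. x $ i \<ge> 0) \<and> (\<forall>i. x $ i * (1 - z $ i) = 0)}"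

definition setX :: "(real^'n \<Rightarrow> ereal) \<Rightarrow> 'n set \<Rightarrow> (real \<times> (real^'n)) set" where
  "setX f Ip = {(t, x). f x \<le> ereal t \<and> (\<forall>i\<in>Ip. x $ i \<ge> 0)}"

definition setX_on :: "(real^'n \<Rightarrow> ereal) \<Rightarrow> 'n set \<Rightarrow> 'n set \<Rightarrow> (real \<times> (real^'n)) set" where
  "setX_on f Ip I = setX f Ip \<inter> {(t, x). \<forall>i. i \<notin> I \<longrightarrow> x $ i = 0}"

definition setZ_on :: "'n set \<Rightarrow> (real^'n) set" where
  "setZ_on I = {z. (\<forall>i. z $ i \<in> {0, 1}) \<and> (\<forall>i\<in>I. z $ i = 1)}"

definition setV :: "(real^'n \<Rightarrow> ereal) \<Rightarrow> 'n set \<Rightarrow> 'n set \<Rightarrow> ((real \<times> (real^'n)) \<times> (real^'n)) set" where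
  "setV f Ip I = setX_on f Ip I \<times> setZ_on I"

definition setR :: "nat \<Rightarrow> (nat \<Rightarrow> real^'n) \<Rightarrow> real^'n \<Rightarrow> 'n set \<Rightarrow>
    ((real \<times> (real^'n)) \<times> (real^'n)) set" where
  "setR k A c Ip = {((t, x), z). t \<ge> c \<bullet> x \<and> mat_app k A x = (\<lambda>i. 0) \<and>
     (\<forall>i\<in>Ip. x $ i \<ge> 0) \<and> (\<forall>i. z $ i = 1)}"

end

theory Submission
  imports Defs
begin

text \<open>
  The left-hand side contains the right-hand side because every \<^term>\<open>setV f Ip I\<close> and
  \<^term>\<open>setR k A c Ip\<close> already lie in \<^term>\<open>setQ f Ip\<close>; for the latter, \<open>f 0 = 0\<close> forces \<open>g 0 = 0\<close>,
  so \<open>f x = c \<bullet> x\<close> on the kernel of the matrix.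

  For the converse, fix a point \<open>(t, x, z)\<close> of \<^term>\<open>setQ f Ip\<close>.  On the fibre of vectors \<open>v\<close> with
  \<open>A v = A x\<close> the nonlinear part \<open>g (A v)\<close> is constant, so there \<open>f\<close> is affine with slope \<open>c\<close>, and
  convex combinations of points of that fibre cost nothing.  The vectors of the fibre that lie in the
  same closed orthant as \<open>x\<close> and vanish wherever \<open>x\<close> does form a polyhedron without lines, defined by
  \<open>k\<close> equations and sign constraints.  Its vertices have at most \<open>k\<close> nonzero coordinates, and its
  recession directions are the kernel vectors under the same sign and support conditions.  Hence
  \<open>x = w + d\<close> with \<open>w\<close> a convex combination of sparse vectors and \<open>d\<close> such a direction (lemma \<open>conformal_decomposition\<close>).  The vector \<open>z\<close>
  remains admissible for each sparse vector since supports only shrink, so \<open>(t - c \<bullet> d, w, z)\<close> is in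
  the convex hull of the sets \<^term>\<open>setV f Ip I\<close>.  A trivial kernel cone forces \<open>d = 0\<close>, and then this
  is the original point.  In general the ray from \<open>(0, 0, 1)\<close> in direction \<open>(c \<bullet> d, d, 0)\<close> lies in
  \<^term>\<open>setR k A c Ip\<close>, and a closed convex set that contains a ray is stable under translation along
  it (lemma \<open>closed_convex_add_ray_direction\<close>).
\<close>

section \<open>Sparse decompositions in an orthant\<close>

definition supp :: "real^'n \<Rightarrow> 'n set" where
  "supp x = {i. x $ i \<noteq> 0}"

text \<open>The vectors in the smallest closed face of an orthant that contains \<open>x\<close>.\<close>

definition conformal :: "real^'n \<Rightarrow> (real^'n) set" where
  "conformal x = {v. supp v \<subseteq> supp x \<and> (\<forall>i. 0 \<le> x $ i * v $ i)}"

lemma conformal_self: "x \<in> conformal x"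
  by (simp add: conformal_def)

lemma conformal_zero: "0 \<in> conformal x"
  by (simp add: conformal_def supp_def)

lemma conformal_trans:
  assumes "v \<in> conformal y" "y \<in> conformal x"
  shows "v \<in> conformal x"
proof -
  have "0 \<le> x $ i * v $ i" for i
  proof (cases "y $ i = 0")
    case True
    then have "v $ i = 0"
      using assms(1) by (auto simp: conformal_def supp_def)
    then show ?thesis by simp
  next
    case False
    have "0 \<le> y $ i * v $ i" "0 \<le> x $ i * y $ i"
      using assms by (auto simp: conformal_def)
    with False show ?thesis
      by (auto simp: zero_le_mult_iff)
  qed
  then show ?thesis
    using assms by (auto simp: conformal_def)
qed

lemma conformal_add:
  assumes "v \<in> conformal x" "w \<in> conformal x"
  shows "v + w \<in> conformal x"
proof -
  have "0 \<le> x $ i * (v + w) $ i" for i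
    using assms by (simp add: conformal_def distrib_left)
  moreover have "supp (v + w) \<subseteq> supp v \<union> supp w"
    by (auto simp: supp_def)
  ultimately show ?thesis
    using assms by (auto simp: conformal_def)
qed

lemma conformal_scaleR:
  assumes "v \<in> conformal x" "0 \<le> r"
  shows "r *\<^sub>R v \<in> conformal x"
proof -
  have "0 \<le> r * (x $ i * v $ i)" for i
    using assms by (simp add: conformal_def)
  then show ?thesis
    using assms(1) by (auto simp: conformal_def supp_def mult_ac)
qed

text \<open>The vectors supported on \<open>S\<close> form a space of dimension \<^term>\<open>card S\<close>, in which fewer than
  \<^term>\<open>card S\<close> linear equations leave a nonzero solution.\<close>

lemma nonzero_orthogonal_supported:
  fixes B :: "(real^'n) set"
  assumes "finite B" "card B < card S"
  obtains h where "h \<noteq> 0" "supp h \<subseteq> S" "\<forall>b\<in>B. b \<bullet> h = 0"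
proof -
  define T :: "(real^'n) set" where "T = {v. \<forall>i. i \<notin> S \<longrightarrow> v $ i = 0}"
  define proj :: "real^'n \<Rightarrow> real^'n" where "proj v = (\<chi> i. if i \<in> S then v $ i else 0)" for v
  have "subspace T"
    by (auto simp: T_def subspace_def)
  have dim_T: "dim T = card S"
    unfolding T_def dim_vec_eq[symmetric] by (rule dim_substandard_cart)
  have "proj ` B \<subseteq> T"
    by (auto simp: proj_def T_def)
  then have sub: "span (proj ` B) \<subseteq> span T"
    by (rule span_mono)
  have "dim (proj ` B) \<le> card B"
    using assms(1) by (meson card_image_le dim_le_card' finite_imageI order_trans)
  then have "span (proj ` B) \<noteq> span T"
    using assms(2) dim_T by (metis dim_span not_less)
  with sub have "span (proj ` B) \<subset> span T"
    by blast
  then obtain h where h: "h \<noteq> 0" "h \<in> span T" "\<And>y. y \<in> span (proj ` B) \<Longrightarrow> orthogonal h y"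
    using orthogonal_to_subspace_exists_gen[of "proj ` B" T] by blast
  have "h \<in> T"
    using h(2) \<open>subspace T\<close> by (metis span_eq_iff)
  have "b \<bullet> h = 0" if "b \<in> B" for b
  proof -
    have "b \<bullet> h = proj b \<bullet> h"
      using \<open>h \<in> T\<close> unfolding inner_vec_def
      by (intro sum.cong) (auto simp: proj_def T_def)
    also have "\<dots> = 0"
      using h(3)[of "proj b"] that by (simp add: span_base orthogonal_def inner_commute)
    finally show ?thesis .
  qed
  moreover have "supp h \<subseteq> S"
    using \<open>h \<in> T\<close> by (auto simp: T_def supp_def)
  ultimately show ?thesis
    using h(1) that by blast
qed

text \<open>A direction that decreases the absolute value of some coordinate leads out of the orthant;
  stopping at the first coordinate that vanishes shrinks the support.\<close>

lemma move_until_support_shrinks: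
  assumes "supp h \<subseteq> supp x" "x $ j * h $ j < 0"
  obtains r where "0 < r" "x + r *\<^sub>R h \<in> conformal x" "supp (x + r *\<^sub>R h) \<subset> supp x"
proof -
  define N where "N = {i. x $ i * h $ i < 0}"
  define r where "r = Min ((\<lambda>i. - x $ i / h $ i) ` N)"
  have "finite N" "N \<noteq> {}"
    using assms(2) by (auto simp: N_def)
  then have "r \<in> (\<lambda>i. - x $ i / h $ i) ` N"
    unfolding r_def by (intro Min_in) auto
  then obtain m where m: "m \<in> N" "r = - x $ m / h $ m"
    by blast
  have "0 < r"
    using m by (auto simp: N_def mult_less_0_iff divide_less_0_iff)
  have nonneg: "0 \<le> x $ i * (x + r *\<^sub>R h) $ i" for i
  proof (cases "i \<in> N")
    case True
    have "r \<le> - x $ i / h $ i"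
      unfolding r_def using True \<open>finite N\<close> by simp
    then have "(- x $ i / h $ i) * (x $ i * h $ i) \<le> r * (x $ i * h $ i)"
      using True by (intro mult_right_mono_neg) (auto simp: N_def)
    moreover have "h $ i \<noteq> 0"
      using True by (auto simp: N_def)
    ultimately show ?thesis
      by (simp add: algebra_simps)
  next
    case False
    then have "0 \<le> r * (x $ i * h $ i)"
      using \<open>0 < r\<close> by (simp add: N_def)
    moreover have "0 \<le> x $ i * x $ i"
      by simp
    ultimately show ?thesis
      by (simp add: distrib_left mult_ac)
  qed
  have sub: "supp (x + r *\<^sub>R h) \<subseteq> supp x"
    using assms(1) by (auto simp: supp_def)
  have "m \<notin> supp (x + r *\<^sub>R h)" "m \<in> supp x"
    using m by (auto simp: supp_def N_def)
  with sub have "supp (x + r *\<^sub>R h) \<subset> supp x"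
    by blast
  then show ?thesis
    using that \<open>0 < r\<close> nonneg sub by (auto simp: conformal_def)
qed

text \<open>The Minkowski-Weyl decomposition of the polyhedron of all \<open>v\<close> conformal to \<open>x\<close> with
  \<open>b \<bullet> v = b \<bullet> x\<close> for \<open>b \<in> B\<close>, with the vertices replaced by the larger set of its sparse
  points.  As long as the support of \<open>x\<close> has more than \<^term>\<open>card B\<close> elements, some nonzero \<open>h\<close>
  with support in that of \<open>x\<close> is orthogonal to \<open>B\<close>.  Moving
  from \<open>x\<close> along \<open>h\<close> and along \<open>- h\<close> either leaves the orthant both ways, so that \<open>x\<close> is between
  two points of smaller support, or one of the two is a recession direction and only the other
  leads to such a point.\<close>

lemma conformal_decomposition:
  fixes B :: "(real^'n) set"
  assumes "finite B"
  shows "\<exists>w d. x = w + d \<and>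
    w \<in> convex hull {v \<in> conformal x. (\<forall>b\<in>B. b \<bullet> v = b \<bullet> x) \<and> card (supp v) \<le> card B} \<and>
    d \<in> conformal x \<and> (\<forall>b\<in>B. b \<bullet> d = 0)"
proof (induction "card (supp x)" arbitrary: x rule: less_induct)
  case less
  define S where "S y = {v \<in> conformal y. (\<forall>b\<in>B. b \<bullet> v = b \<bullet> y) \<and> card (supp v) \<le> card B}"
    for y :: "real^'n"
  define D where "D = {d \<in> conformal x. \<forall>b\<in>B. b \<bullet> d = 0}"
  have smaller: "\<exists>w d. y = w + d \<and> w \<in> convex hull S x \<and> d \<in> D"
    if y: "y \<in> conformal x" "supp y \<subset> supp x" "\<forall>b\<in>B. b \<bullet> y = b \<bullet> x" for y
  proof -
    have "card (supp y) < card (supp x)"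
      using y(2) by (simp add: psubset_card_mono)
    from less[OF this] obtain w d where
      wd: "y = w + d" "w \<in> convex hull S y" "d \<in> conformal y" "\<forall>b\<in>B. b \<bullet> d = 0"
      unfolding S_def by blast
    have "S y \<subseteq> S x"
      using y by (auto simp: S_def intro: conformal_trans)
    then have "w \<in> convex hull S x"
      using wd(2) hull_mono[of "S y" "S x" convex] by blast
    moreover have "d \<in> D"
      using wd(3,4) conformal_trans[OF wd(3) y(1)] by (simp add: D_def)
    ultimately show ?thesis
      using wd(1) by blast
  qed
  have "\<exists>w d. x = w + d \<and> w \<in> convex hull S x \<and> d \<in> D"
  proof (cases "card (supp x) \<le> card B")
    case True
    then have "x \<in> S x"
      by (simp add: S_def conformal_self)
    then have "x \<in> convex hull S x"
      by (rule hull_inc)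
    moreover have "0 \<in> D"
      by (simp add: D_def conformal_zero)
    ultimately show ?thesis
      by (metis add.right_neutral)
  next
    case False
    then obtain h0 where h0: "h0 \<noteq> 0" "supp h0 \<subseteq> supp x" "\<forall>b\<in>B. b \<bullet> h0 = 0"
      using nonzero_orthogonal_supported[OF assms, of "supp x"] by (metis not_le)
    then obtain j where j: "h0 $ j \<noteq> 0"
      by (auto simp: vec_eq_iff)
    then have "x $ j \<noteq> 0"
      using h0(2) by (auto simp: supp_def)
    \<comment> \<open>The sign of the direction is chosen such that it leaves the orthant.\<close>
    define h where "h = (if x $ j * h0 $ j < 0 then h0 else - h0)"
    have h: "supp h \<subseteq> supp x" "\<forall>b\<in>B. b \<bullet> h = 0"
      using h0 by (auto simp: h_def supp_def)
    have "x $ j * h0 $ j \<noteq> 0"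
      using j \<open>x $ j \<noteq> 0\<close> by simp
    then have "x $ j * h $ j < 0"
      by (auto simp: h_def not_less order_less_le)
    with h(1) obtain r where r: "0 < r" "x + r *\<^sub>R h \<in> conformal x"
      "supp (x + r *\<^sub>R h) \<subset> supp x"
      by (rule move_until_support_shrinks)
    obtain w1 d1 where 1: "x + r *\<^sub>R h = w1 + d1" "w1 \<in> convex hull S x" "d1 \<in> D"
      using smaller[OF r(2,3)] h(2) by (auto simp: inner_add_right)
    have supp_minus: "supp (- h) \<subseteq> supp x"
      using h(1) by (simp add: supp_def)
    show ?thesis
    proof (cases "- h \<in> conformal x")
      case True
      then have "r *\<^sub>R (- h) \<in> conformal x"
        using r(1) by (intro conformal_scaleR) auto
      then have "d1 + r *\<^sub>R (- h) \<in> conformal x"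
        using 1(3) by (intro conformal_add) (auto simp: D_def)
      then have "d1 + r *\<^sub>R (- h) \<in> D"
        using 1(3) h(2) by (simp add: D_def inner_diff_right)
      moreover have "x = w1 + (d1 + r *\<^sub>R (- h))"
        using 1(1) by (simp add: algebra_simps)
      ultimately show ?thesis
        using 1(2) by blast
    next
      case False
      then obtain i where "x $ i * (- h) $ i < 0"
        using supp_minus by (auto simp: conformal_def not_le)
      with supp_minus obtain s where s: "0 < s" "x + s *\<^sub>R (- h) \<in> conformal x"
        "supp (x + s *\<^sub>R (- h)) \<subset> supp x"
        by (rule move_until_support_shrinks)
      obtain w2 d2 where 2: "x + s *\<^sub>R (- h) = w2 + d2" "w2 \<in> convex hull S x" "d2 \<in> D"
        using smaller[OF s(2,3)] h(2) by (auto simp: inner_diff_right)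
      define u where "u = s / (r + s)"
      define v where "v = r / (r + s)"
      have uv: "0 \<le> u" "0 \<le> v" "u + v = 1" and ur: "u * r = v * s"
        using r(1) s(1) by (auto simp: u_def v_def add_divide_distrib[symmetric])
      have "x = u *\<^sub>R (x + r *\<^sub>R h) + v *\<^sub>R (x + s *\<^sub>R (- h))"
        using uv(3) ur by (simp add: algebra_simps flip: scaleR_left_distrib)
      also have "\<dots> = (u *\<^sub>R w1 + v *\<^sub>R w2) + (u *\<^sub>R d1 + v *\<^sub>R d2)"
        by (simp only: 1(1) 2(1) scaleR_add_right add_ac)
      finally have "x = (u *\<^sub>R w1 + v *\<^sub>R w2) + (u *\<^sub>R d1 + v *\<^sub>R d2)" .
      moreover have "u *\<^sub>R w1 + v *\<^sub>R w2 \<in> convex hull S x"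
        using 1(2) 2(2) uv by (intro convexD[OF convex_convex_hull])
      moreover have "u *\<^sub>R d1 + v *\<^sub>R d2 \<in> D"
        using 1(3) 2(3) uv by (auto simp: D_def inner_add_right intro: conformal_add conformal_scaleR)
      ultimately show ?thesis
        by blast
    qed
  qed
  then show ?case
    unfolding S_def D_def by blast
qed

section \<open>Convex hulls\<close>

lemma closed_convex_add_ray_direction:
  fixes C :: "'a::real_normed_vector set"
  assumes "closed C" "convex C" "p \<in> C" and ray: "\<And>r. 0 \<le> r \<Longrightarrow> e + r *\<^sub>R d \<in> C"
  shows "p + d \<in> C"
proof -
  define X where "X n = (1 - inverse (real (Suc n))) *\<^sub>R p
    + inverse (real (Suc n)) *\<^sub>R (e + real (Suc n) *\<^sub>R d)" for n
  have "X n \<in> C" for n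
    unfolding X_def using assms(3) ray[of "real (Suc n)"]
    by (intro convexD[OF assms(2)]) (auto simp: field_simps)
  moreover have "X \<longlonglongrightarrow> p + d"
  proof -
    have "X = (\<lambda>n. (1 - inverse (real (Suc n))) *\<^sub>R p + inverse (real (Suc n)) *\<^sub>R e + d)"
      by (auto simp: X_def fun_eq_iff scaleR_add_right simp del: of_nat_Suc)
    moreover have "\<dots> \<longlonglongrightarrow> (1 - 0) *\<^sub>R p + 0 *\<^sub>R e + d"
      by (intro tendsto_intros LIMSEQ_inverse_real_of_nat)
    ultimately show ?thesis
      by simp
  qed
  ultimately show ?thesis
    using closed_sequentially[OF assms(1)] by blast
qed

lemma convex_hull_affine_image:
  fixes F :: "'a::real_vector \<Rightarrow> 'b::real_vector"
  assumes affine: "\<And>u v a b. u + v = 1 \<Longrightarrow> F (u *\<^sub>R a + v *\<^sub>R b) = u *\<^sub>R F a + v *\<^sub>R F b"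
    and "w \<in> convex hull S" and "F ` S \<subseteq> T"
  shows "F w \<in> convex hull T"
proof -
  have "convex (F -` (convex hull T))"
    by (intro convexI) (simp add: affine convexD[OF convex_convex_hull])
  moreover have "S \<subseteq> F -` (convex hull T)"
    using assms(3) hull_subset[of T convex] by auto
  ultimately show ?thesis
    using assms(2) hull_minimal[of S _ convex] by blast
qed

section \<open>The disjunctive representation\<close>

lemma setV_subset_setQ: "setV f Ip I \<subseteq> setQ f Ip"
  by (fastforce simp: setV_def setX_on_def setX_def setZ_on_def setQ_def)

lemma mat_app_eq_iff: "mat_app k A v = mat_app k A x \<longleftrightarrow> (\<forall>b\<in>A ` {..<k}. b \<bullet> v = b \<bullet> x)"
  by (auto simp: mat_app_def fun_eq_iff)

lemma mat_app_zero: "mat_app k A 0 = (\<lambda>i. 0)"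
  by (simp add: mat_app_def fun_eq_iff)

text \<open>Finiteness of \<^term>\<open>f 0\<close> makes \<open>f\<close> linear on the kernel of the matrix, with the slope that
  bounds \<open>t\<close> in \<^const>\<open>setR\<close>.\<close>

lemma setR_subset_setQ:
  assumes f: "\<And>x. f x = g (mat_app k A x) + ereal (c \<bullet> x)" and "f 0 = 0"
  shows "setR k A c Ip \<subseteq> setQ f Ip"
proof -
  have "g (\<lambda>i. 0) = 0"
    using f[of 0] assms(2) by (simp add: mat_app_zero)
  then show ?thesis
    by (auto simp: setR_def setQ_def f)
qed

text \<open>Along the fibre of \<open>x\<close> the value of \<open>t\<close> follows the affine function of slope \<open>c\<close> through
  \<open>(x, t)\<close>, which keeps it above \<open>f\<close>; the remaining direction \<open>d\<close> is paid for by \<open>c \<bullet> d\<close>.\<close>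

lemma setQ_decomposition:
  assumes f: "\<And>x. f x = g (mat_app k A x) + ereal (c \<bullet> x)"
    and Q: "((t, x), z) \<in> setQ f Ip"
  obtains d where "((t - c \<bullet> d, x - d), z) \<in> convex hull (\<Union>I\<in>{I. card I \<le> k}. setV f Ip I)"
    and "mat_app k A d = (\<lambda>i. 0)" and "\<forall>i\<in>Ip. 0 \<le> d $ i"
proof -
  define B where "B = A ` {..<k}"
  have "finite B"
    by (simp add: B_def)
  have "card B \<le> k"
    unfolding B_def using card_image_le[of "{..<k}" A] by simp
  define S where "S = {v \<in> conformal x. (\<forall>b\<in>B. b \<bullet> v = b \<bullet> x) \<and> card (supp v) \<le> card B}"
  define F where "F v = ((t - c \<bullet> x + c \<bullet> v, v), z)" for v
  obtain w d where wd: "x = w + d" "w \<in> convex hull S" "d \<in> conformal x" "\<forall>b\<in>B. b \<bullet> d = 0"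
    unfolding S_def using conformal_decomposition[OF \<open>finite B\<close>] by blast
  have sign: "0 \<le> v $ i" if "v \<in> conformal x" "i \<in> Ip" for v i
  proof (cases "x $ i = 0")
    case True
    then have "v $ i = 0"
      using that(1) by (auto simp: conformal_def supp_def)
    then show ?thesis by simp
  next
    case False
    then have "0 < x $ i"
      using Q that(2) by (auto simp: setQ_def order_less_le)
    moreover have "0 \<le> x $ i * v $ i"
      using that(1) by (simp add: conformal_def)
    ultimately show ?thesis
      by (simp add: zero_le_mult_iff)
  qed
  have "F v \<in> setV f Ip (supp v)" if "v \<in> S" for v
  proof -
    have v: "v \<in> conformal x" "mat_app k A v = mat_app k A x"
      using that by (auto simp: S_def B_def mat_app_eq_iff)
    have "g (mat_app k A x) + ereal (c \<bullet> x) \<le> ereal t"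
      using Q by (simp add: setQ_def f)
    then have "f v \<le> ereal (t - c \<bullet> x + c \<bullet> v)"
      unfolding f v(2) by (cases "g (mat_app k A x)") auto
    moreover have "\<forall>i\<in>supp v. z $ i = 1"
      using Q v(1) by (auto simp: setQ_def conformal_def supp_def)
    ultimately show ?thesis
      using Q sign[OF v(1)]
      by (auto simp: F_def setV_def setX_on_def setX_def setZ_on_def setQ_def supp_def)
  qed
  moreover have "card (supp v) \<le> k" if "v \<in> S" for v
    using that \<open>card B \<le> k\<close> by (simp add: S_def)
  ultimately have "F ` S \<subseteq> (\<Union>I\<in>{I. card I \<le> k}. setV f Ip I)"
    by blast
  moreover have "F (u *\<^sub>R a + v *\<^sub>R b) = u *\<^sub>R F a + v *\<^sub>R F b" if "u + v = 1" for u v a b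
  proof -
    have "u * (t - c \<bullet> x) + v * (t - c \<bullet> x) = t - c \<bullet> x"
      using that by (simp flip: distrib_right)
    moreover have "u *\<^sub>R z + v *\<^sub>R z = z"
      using that by (simp flip: scaleR_left_distrib)
    ultimately show ?thesis
      by (simp add: F_def inner_add_right distrib_left)
  qed
  ultimately have "F w \<in> convex hull (\<Union>I\<in>{I. card I \<le> k}. setV f Ip I)"
    using convex_hull_affine_image[of F w S] wd(2) by presburger
  moreover have "F w = ((t - c \<bullet> d, x - d), z)"
    using wd(1) by (simp add: F_def inner_add_right)
  moreover have "mat_app k A d = (\<lambda>i. 0)"
    using wd(4) mat_app_eq_iff[of k A d 0] by (simp add: B_def mat_app_zero)
  ultimately show ?thesis
    using that sign[OF wd(3)] by simp
qed


theorem theorem1: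
  fixes f :: "real^'n \<Rightarrow> ereal" and g :: "(nat \<Rightarrow> real) \<Rightarrow> ereal"
    and k :: nat and A :: "nat \<Rightarrow> real^'n" and c :: "real^'n" and Ip :: "'n set"
  assumes "proper_on UNIV f" and "closed_convex_fun f"
    and "fun_rank f \<le> k"
    and "proper_on (Rvec k) g" and "closed_convex_fun_Rvec k g"
    and "\<And>x. f x = g (mat_app k A x) + ereal (c \<bullet> x)"
    and "f 0 = 0"
  shows "closure (convex hull (setQ f Ip)) =
           closure (convex hull ((\<Union>I\<in>{I. card I \<le> k}. setV f Ip I) \<union> setR k A c Ip)) \<and>
         ({x. mat_app k A x = (\<lambda>i. 0) \<and> (\<forall>i\<in>Ip. x $ i \<ge> 0)} = {0} \<longrightarrow>
           closure (convex hull (setQ f Ip)) =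
           closure (convex hull (\<Union>I\<in>{I. card I \<le> k}. setV f Ip I)))"
proof -
  let ?V = "\<Union>I\<in>{I. card I \<le> k}. setV f Ip I"
  let ?R = "setR k A c Ip"
  let ?C = "closure (convex hull (?V \<union> ?R))"
  note f_eq = assms(6)
  have V_sub: "?V \<subseteq> setQ f Ip"
    using setV_subset_setQ by blast
  have R_sub: "?R \<subseteq> setQ f Ip"
    by (rule setR_subset_setQ[of f g k A c, OF f_eq assms(7)])
  have "closed ?C" "convex ?C"
    by (auto simp: convex_closure convex_convex_hull)
  have "setQ f Ip \<subseteq> ?C"
  proof clarify
    fix t x z assume "((t, x), z) \<in> setQ f Ip"
    then obtain d where
      base: "((t - c \<bullet> d, x - d), z) \<in> convex hull ?V"
      and d: "mat_app k A d = (\<lambda>i. 0)" "\<forall>i\<in>Ip. 0 \<le> d $ i"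
      by (rule setQ_decomposition[of f g k A c, OF f_eq])
    have "((t - c \<bullet> d, x - d), z) \<in> ?C"
      using base hull_mono[of ?V "?V \<union> ?R" convex] closure_subset[of "convex hull (?V \<union> ?R)"]
      by blast
    moreover have "((0, 0), 1) + r *\<^sub>R ((c \<bullet> d, d), 0) \<in> ?C" if "0 \<le> r" for r
    proof -
      have "A i \<bullet> d = 0" if "i < k" for i
        using fun_cong[OF d(1), of i] that by (simp add: mat_app_def)
      then have "((0, 0), 1) + r *\<^sub>R ((c \<bullet> d, d), 0) \<in> ?R"
        using d(2) \<open>0 \<le> r\<close> by (auto simp: setR_def mat_app_def)
      then show ?thesis
        using hull_subset[of "?V \<union> ?R" convex] closure_subset[of "convex hull (?V \<union> ?R)"] by blast
    qed
    ultimately have "((t - c \<bullet> d, x - d), z) + ((c \<bullet> d, d), 0) \<in> ?C"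
      by (rule closed_convex_add_ray_direction[OF \<open>closed ?C\<close> \<open>convex ?C\<close>])
    then show "((t, x), z) \<in> ?C"
      by simp
  qed
  then have "closure (convex hull (setQ f Ip)) \<subseteq> ?C"
    using \<open>closed ?C\<close> \<open>convex ?C\<close> by (intro closure_minimal hull_minimal) auto
  moreover have "?C \<subseteq> closure (convex hull (setQ f Ip))"
    using V_sub R_sub by (intro closure_mono hull_mono) auto
  ultimately have first: "closure (convex hull (setQ f Ip)) = ?C"
    by (rule subset_antisym)
  have second: "closure (convex hull (setQ f Ip)) = closure (convex hull ?V)"
    if trivial: "{x. mat_app k A x = (\<lambda>i. 0) \<and> (\<forall>i\<in>Ip. x $ i \<ge> 0)} = {0}"
  proof
    have "setQ f Ip \<subseteq> convex hull ?V"
    proof clarify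
      fix t x z assume "((t, x), z) \<in> setQ f Ip"
      then obtain d where
        base: "((t - c \<bullet> d, x - d), z) \<in> convex hull ?V"
        and "mat_app k A d = (\<lambda>i. 0)" "\<forall>i\<in>Ip. 0 \<le> d $ i"
        by (rule setQ_decomposition[of f g k A c, OF f_eq])
      then have "d = 0"
        using trivial by blast
      with base show "((t, x), z) \<in> convex hull ?V"
        by simp
    qed
    then show "closure (convex hull (setQ f Ip)) \<subseteq> closure (convex hull ?V)"
      by (intro closure_mono hull_minimal) auto
    show "closure (convex hull ?V) \<subseteq> closure (convex hull (setQ f Ip))"
      using V_sub by (intro closure_mono hull_mono)
  qed
  show ?thesis
    using first second by simp
qed

end
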